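(* Let $(\mathcal{H}, \langle \cdot,\cdot\rangle)$ be a complex separable Hilbert space with norm $\|\cdot\|_{\mathcal{H}}$. Let $\phi,\psi\in\mathcal{H}$ and let $A$ be a contraction on $\mathcal{H}$. Define the holomorphic function $h$ on the open unit disk $\mathbb{D}$ by $$h(w)=1+w\,\langle (I-wA)^{-1}\phi,\psi\rangle,\qquad w\in\mathbb{D}.$$ Then $$\sum_{z\in\mathcal{Z}(h)}\left(|z|^{-1}-1\right)\leq \|\phi\|_{\mathcal{H}}\,\|\psi\|_{\mathcal{H}},$$ where each zero is counted according to its order.
   Context: $\mathbb{D}=\{w\in\mathbb{C}:|w|<1\}$. A contraction on $\mathcal{H}$ is a bounded linear operator $A:\mathcal{H}\to\mathcal{H}$ with $\|A\|\le 1$. The inner product is linear in its first component. $\mathcal{Z}(h)$ denotes the set of zeros of $h$ in $\mathbb{D}$; the sum counts each zero as many times as its order as a zero of $h$ (note $h(0)=1$, so $0\notin\mathcal{Z}(h)$). *)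

theory Defs
  imports "HOL-Complex_Analysis.Complex_Analysis"
begin

(* The inner product is linear in its first and conjugate-linear in its second argument.
   Definiteness is not listed separately: it follows from the axioms of the norm. *)
class complex_inner = real_normed_vector +
  fixes scaleC :: "complex \<Rightarrow> 'a \<Rightarrow> 'a" (infixr "*\<^sub>C" 75)
    and cinner :: "'a \<Rightarrow> 'a \<Rightarrow> complex"
  assumes scaleR_scaleC: "scaleR r x = scaleC (complex_of_real r) x"
    and scaleC_add_right: "scaleC a (x + y) = scaleC a x + scaleC a y"
    and scaleC_add_left: "scaleC (a + b) x = scaleC a x + scaleC b x"
    and scaleC_scaleC: "scaleC a (scaleC b x) = scaleC (a * b) x"
    and scaleC_one: "scaleC 1 x = x"
    and cinner_commute: "cinner x y = cnj (cinner y x)"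
    and cinner_add_left: "cinner (x + y) z = cinner x z + cinner y z"
    and cinner_scaleC_left: "cinner (scaleC a x) y = a * cinner x y"
    and norm_eq_sqrt_cinner: "norm x = sqrt (Re (cinner x x))"

class complex_hilbert = complex_inner + complete_space
begin
subclass banach ..
end

instantiation complex :: complex_hilbert
begin
definition scaleC_complex :: "complex \<Rightarrow> complex \<Rightarrow> complex"
  where "scaleC_complex a x = a * x"
definition cinner_complex :: "complex \<Rightarrow> complex \<Rightarrow> complex"
  where "cinner_complex x y = x * cnj y"
instance
  by standard
    (auto simp: scaleC_complex_def cinner_complex_def algebra_simps scaleR_conv_of_real
      cmod_def power2_eq_square)
end

definition contraction :: "('a::complex_inner \<Rightarrow> 'a) \<Rightarrow> bool" where
  "contraction A \<longleftrightarrow>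
     bounded_linear A \<and> (\<forall>c x. A (c *\<^sub>C x) = c *\<^sub>C A x) \<and> onorm A \<le> 1"

(* inv is the genuine inverse for |w| < 1, see bij_id_minus_contraction below. *)
definition resolvent_fun ::
    "('a::complex_inner \<Rightarrow> 'a) \<Rightarrow> 'a \<Rightarrow> 'a \<Rightarrow> complex \<Rightarrow> complex" where
  "resolvent_fun A \<phi> \<psi> w = 1 + w * cinner (inv (\<lambda>x. x - w *\<^sub>C A x) \<phi>) \<psi>"

definition disc_zeros :: "(complex \<Rightarrow> complex) \<Rightarrow> complex set" where
  "disc_zeros h = {z \<in> ball 0 1. h z = 0}"

lemma cinner_self: "cinner x x = complex_of_real ((norm x)\<^sup>2)"
  for x :: "'a::complex_inner"
proof -
  have "Im (cinner x x) = 0"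
    using arg_cong[OF cinner_commute[of x x], of Im] by simp
  moreover have "Re (cinner x x) = (norm x)\<^sup>2"
    using norm_ge_zero[of x] unfolding norm_eq_sqrt_cinner by simp
  ultimately show ?thesis by (simp add: complex_eq_iff)
qed

lemma cinner_add_right: "cinner x (y + z) = cinner x y + cinner x z"
  for x :: "'a::complex_inner"
  by (metis cinner_add_left cinner_commute complex_cnj_add)

lemma cinner_scaleC_right: "cinner x (a *\<^sub>C y) = cnj a * cinner x y"
  for x :: "'a::complex_inner"
  by (metis cinner_scaleC_left cinner_commute complex_cnj_mult)

lemma scaleC_minus1: "(- 1) *\<^sub>C x = - x" for x :: "'a::complex_inner"
  using scaleR_scaleC[of "- 1" x] by simp

lemma scaleC_minus_right: "a *\<^sub>C (- x) = - (a *\<^sub>C x)" for x :: "'a::complex_inner"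
  by (metis scaleC_minus1 scaleC_scaleC mult.commute)

lemma scaleC_diff_right: "a *\<^sub>C (x - y) = a *\<^sub>C x - a *\<^sub>C y" for x :: "'a::complex_inner"
  using scaleC_add_right[of a x "- y"] by (simp add: scaleC_minus_right)

lemma cinner_minus_left: "cinner (- x) y = - cinner x y" for x :: "'a::complex_inner"
  using cinner_scaleC_left[of "- 1" x y] by (simp add: scaleC_minus1)

lemma cinner_minus_right: "cinner x (- y) = - cinner x y" for x :: "'a::complex_inner"
  using cinner_scaleC_right[of x "- 1" y] by (simp add: scaleC_minus1)

lemma cinner_diff_left: "cinner (x - y) z = cinner x z - cinner y z" for x :: "'a::complex_inner"
  using cinner_add_left[of x "- y" z] by (simp add: cinner_minus_left)

lemma cinner_diff_right: "cinner x (y - z) = cinner x y - cinner x z" for x :: "'a::complex_inner"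
  using cinner_add_right[of x y "- z"] by (simp add: cinner_minus_right)

lemma norm_scaleC: "norm (a *\<^sub>C x) = cmod a * norm x" for x :: "'a::complex_inner"
proof -
  have "complex_of_real ((norm (a *\<^sub>C x))\<^sup>2) = complex_of_real ((cmod a * norm x)\<^sup>2)"
    unfolding cinner_self[symmetric] cinner_scaleC_left cinner_scaleC_right
    by (simp add: cinner_self power_mult_distrib complex_norm_square[unfolded of_real_power]
          mult.commute[of "cnj a" a])
  then have "(norm (a *\<^sub>C x))\<^sup>2 = (cmod a * norm x)\<^sup>2"
    unfolding of_real_eq_iff .
  then show ?thesis by (simp add: power2_eq_iff_nonneg)
qed

lemma cinner_Cauchy_Schwarz: "cmod (cinner x y) \<le> norm x * norm y"
  for x :: "'a::complex_inner"
proof (cases "y = 0")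
  case True
  then show ?thesis using cinner_add_right[of x 0 0] by simp
next
  case False
  define c where "c = cinner x y / complex_of_real ((norm y)\<^sup>2)"
  have y: "complex_of_real (norm y) \<noteq> 0" using False by simp
  have "complex_of_real ((norm (x - c *\<^sub>C y))\<^sup>2)
      = cinner x x - cnj c * cinner x y - c * cinner y x + c * cnj c * cinner y y"
    unfolding cinner_self[symmetric]
    by (simp add: cinner_diff_left cinner_diff_right cinner_scaleC_left cinner_scaleC_right algebra_simps)
  also have "\<dots> = cinner x x - cinner x y * cnj (cinner x y) / complex_of_real ((norm y)\<^sup>2)"
    using y unfolding cinner_self[of y] cinner_commute[of y x] c_def
    by (simp add: field_simps power2_eq_square)
  also have "\<dots> = complex_of_real ((norm x)\<^sup>2 - (cmod (cinner x y))\<^sup>2 / (norm y)\<^sup>2)"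
    by (simp add: cinner_self complex_norm_square[unfolded of_real_power])
  finally have "(norm (x - c *\<^sub>C y))\<^sup>2 = (norm x)\<^sup>2 - (cmod (cinner x y))\<^sup>2 / (norm y)\<^sup>2"
    unfolding of_real_eq_iff .
  then have "(cmod (cinner x y))\<^sup>2 / (norm y)\<^sup>2 \<le> (norm x)\<^sup>2"
    using zero_le_power2[of "norm (x - c *\<^sub>C y)"] by linarith
  then have "(cmod (cinner x y))\<^sup>2 \<le> (norm x * norm y)\<^sup>2"
    using False by (simp add: divide_le_eq power_mult_distrib)
  then show ?thesis by (rule power2_le_imp_le) simp
qed

lemma contraction_norm_le: "contraction A \<Longrightarrow> norm (A x) \<le> norm x"
  unfolding contraction_def
  by (meson onorm order_trans mult_left_le_one_le norm_ge_zero onorm_pos_le)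

lemma bij_id_minus_contraction:
  fixes A :: "'a::complex_hilbert \<Rightarrow> 'a"
  assumes "contraction A" "cmod w < 1"
  shows "bij (\<lambda>x. x - w *\<^sub>C A x)"
proof -
  interpret bounded_linear A using assms(1) by (simp add: contraction_def)
  have "\<exists>!x. y + w *\<^sub>C A x = x" for y
  proof (rule banach_fix_type[of "cmod w"], goal_cases)
    case 3
    have "dist (y + w *\<^sub>C A u) (y + w *\<^sub>C A v) = cmod w * norm (A (u - v))" for u v
      by (simp add: dist_norm diff norm_scaleC flip: scaleC_diff_right)
    then show ?case
      by (simp add: dist_norm contraction_norm_le[OF assms(1)] mult_left_mono)
  qed (use assms(2) in auto)
  then have "\<exists>!x. y = x - w *\<^sub>C A x" for y
    by (metis add_diff_cancel_right' diff_add_cancel)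
  then show ?thesis unfolding bij_iff by metis
qed

lemma resolvent_fun_holomorphic:
  fixes A :: "'a::complex_hilbert \<Rightarrow> 'a"
  assumes "contraction A"
  shows "resolvent_fun A \<phi> \<psi> holomorphic_on ball 0 1"
proof -
  have A_add: "A (x + y) = A x + A y" for x y
    using assms by (simp add: contraction_def linear_simps)
  have A_scaleC: "A (c *\<^sub>C x) = c *\<^sub>C A x" for c x
    using assms by (simp add: contraction_def)
  have pow_add: "(A ^^ n) (x + y) = (A ^^ n) x + (A ^^ n) y" for n x y
    by (induction n) (auto simp: A_add)
  have pow_scaleC: "(A ^^ n) (c *\<^sub>C x) = c *\<^sub>C (A ^^ n) x" for n c x
    by (induction n) (auto simp: A_scaleC)
  have pow_le: "norm ((A ^^ n) x) \<le> norm x" for n x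
    by (induction n) (auto intro: order_trans[OF contraction_norm_le[OF assms]])
  have "(\<lambda>n. cinner ((A ^^ n) \<phi>) \<psi> * (w - 0) ^ n) sums cinner (inv (\<lambda>x. x - w *\<^sub>C A x) \<phi>) \<psi>"
    if w: "w \<in> ball 0 1" for w
  proof -
    define x where "x = inv (\<lambda>x. x - w *\<^sub>C A x) \<phi>"
    have "x - w *\<^sub>C A x = \<phi>"
      unfolding x_def using bij_id_minus_contraction[OF assms, of w] w
      by (intro surj_f_inv_f[of "\<lambda>x. x - w *\<^sub>C A x"]) (auto simp: bij_is_surj)
    then have x: "x = \<phi> + w *\<^sub>C A x" by (simp add: diff_eq_eq)
    have rem: "cinner x \<psi> - (\<Sum>n<N. cinner ((A ^^ n) \<phi>) \<psi> * w ^ n)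
        = w ^ N * cinner ((A ^^ N) x) \<psi>" for N
    proof (induction N)
      case (Suc N)
      have "(A ^^ N) x = (A ^^ N) \<phi> + w *\<^sub>C (A ^^ Suc N) x"
        by (subst x) (simp add: pow_add pow_scaleC funpow_swap1)
      then have "cinner ((A ^^ N) x) \<psi> = cinner ((A ^^ N) \<phi>) \<psi> + w * cinner ((A ^^ Suc N) x) \<psi>"
        by (simp only: cinner_add_left cinner_scaleC_left)
      with Suc show ?case
        by (simp add: algebra_simps del: funpow.simps)
    qed simp
    have "(\<lambda>N. w ^ N * cinner ((A ^^ N) x) \<psi>) \<longlonglongrightarrow> 0"
    proof (rule Lim_null_comparison)
      show "\<forall>\<^sub>F N in sequentially. norm (w ^ N * cinner ((A ^^ N) x) \<psi>)
          \<le> cmod w ^ N * (norm x * norm \<psi>)"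
        by (intro always_eventually allI)
          (auto simp: norm_mult norm_power intro!: mult_left_mono
            order_trans[OF cinner_Cauchy_Schwarz] mult_right_mono pow_le)
      show "(\<lambda>N. cmod w ^ N * (norm x * norm \<psi>)) \<longlonglongrightarrow> 0"
        using w by (intro tendsto_mult_left_zero LIMSEQ_power_zero) auto
    qed
    then have "(\<lambda>N. cinner x \<psi> - (\<Sum>n<N. cinner ((A ^^ n) \<phi>) \<psi> * w ^ n)) \<longlonglongrightarrow> 0"
      by (simp only: rem)
    from tendsto_diff[OF tendsto_const[of "cinner x \<psi>"] this]
    show ?thesis unfolding sums_def x_def by simp
  qed
  then have "(\<lambda>w. cinner (inv (\<lambda>x. x - w *\<^sub>C A x) \<phi>) \<psi>) holomorphic_on ball 0 1"
    by (rule power_series_holomorphic)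
  then show ?thesis
    unfolding resolvent_fun_def[abs_def] by (intro holomorphic_intros)
qed

end

theory Submission
  imports Defs
begin

text \<open>A zero \<open>z\<close> of \<open>h\<close> makes \<open>x = (I - z A)\<^sup>-\<^sup>1 \<phi>\<close> an eigenvector, for the eigenvalue \<open>1 / z\<close>,
  of the rank-one perturbation \<open>B y = A y - cinner y \<psi> *\<^sub>C \<phi>\<close> of \<open>A\<close>. With \<open>e = x / norm x\<close>,
  \<open>1 / cmod z = cmod (cinner (B e) e) \<le> 1 + cmod (cinner \<phi> e) * cmod (cinner \<psi> e)\<close>.
  Compressing \<open>A\<close>, \<open>\<phi>\<close>, \<open>\<psi>\<close> to the orthogonal complement of \<open>e\<close> gives data of the same kind whose
  function \<open>h'\<close> has the same zeros as \<open>h\<close>, except that the order of \<open>z\<close> drops by one. Iterating over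
  finitely many zeros, the bounds add up by the Cauchy-Schwarz inequality in the plane.\<close>

section \<open>Resolvents of contractions\<close>

lemma resolvent_eqn:
  fixes A :: "'a::complex_hilbert \<Rightarrow> 'a" and y :: 'a
  assumes "contraction A" "cmod w < 1"
  defines "x \<equiv> inv (\<lambda>x. x - w *\<^sub>C A x) y"
  shows "x - w *\<^sub>C A x = y"
  unfolding x_def using bij_id_minus_contraction[OF assms(1,2)]
  by (intro surj_f_inv_f[of "\<lambda>x. x - w *\<^sub>C A x"]) (auto simp: bij_is_surj)

lemma resolvent_unique:
  fixes A :: "'a::complex_hilbert \<Rightarrow> 'a"
  assumes "contraction A" "cmod w < 1" "x - w *\<^sub>C A x = y"
  shows "inv (\<lambda>x. x - w *\<^sub>C A x) y = x"
  using bij_id_minus_contraction[OF assms(1,2)] assms(3)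
  by (intro inv_f_eq) (auto simp: bij_is_inj)

lemma scaleC_diff_left: "(a - b) *\<^sub>C x = a *\<^sub>C x - b *\<^sub>C x" for x :: "'a::complex_inner"
  by (metis add_diff_cancel diff_add_cancel scaleC_add_left)

lemma contraction_linear:
  assumes "contraction A"
  shows "A (x + y) = A x + A y" and "A (x - y) = A x - A y" and "A (c *\<^sub>C x) = c *\<^sub>C A x"
  using assms by (auto simp: contraction_def linear_simps)

section \<open>Projection onto the orthogonal complement of a unit vector\<close>

text \<open>For \<open>norm e = 1\<close> this is the orthogonal projection P onto the complement of
  e. It acts on the whole space, so the compressed data keep their type and can be fed back into an
  induction. The operator used below is P A rather than P A P: its resolvent sends
  \<open>deflate e \<phi>\<close> into the complement of e, where the two agree.\<close>

definition deflate :: "'a::complex_inner \<Rightarrow> 'a \<Rightarrow> 'a" where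
  "deflate e x = x - cinner x e *\<^sub>C e"

lemma norm_deflate:
  fixes e :: "'a::complex_inner"
  assumes "norm e = 1"
  shows "(norm (deflate e x))\<^sup>2 = (norm x)\<^sup>2 - (cmod (cinner x e))\<^sup>2"
proof -
  have ee: "cinner e e = 1" using assms by (simp add: cinner_self)
  have "complex_of_real ((norm (deflate e x))\<^sup>2)
      = cinner x x - cinner x e * cnj (cinner x e)"
    unfolding cinner_self[symmetric] deflate_def
    by (simp add: cinner_diff_left cinner_diff_right cinner_scaleC_left cinner_scaleC_right
        ee flip: cinner_commute[of e x])
  also have "\<dots> = complex_of_real ((norm x)\<^sup>2 - (cmod (cinner x e))\<^sup>2)"
    by (simp add: cinner_self complex_norm_square[unfolded of_real_power])
  finally show ?thesis unfolding of_real_eq_iff .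
qed

lemma norm_deflate_le:
  fixes e :: "'a::complex_inner"
  assumes "norm e = 1"
  shows "norm (deflate e x) \<le> norm x"
  by (rule power2_le_imp_le) (use norm_deflate[OF assms, of x] in auto)

lemma contraction_deflate:
  fixes A :: "'a::complex_inner \<Rightarrow> 'a"
  assumes A: "contraction A" and e: "norm e = 1"
  shows "contraction (\<lambda>x. deflate e (A x))"
proof -
  have le: "norm (deflate e (A x)) \<le> norm x" for x
    using norm_deflate_le[OF e] contraction_norm_le[OF A] order_trans by blast
  have C: "deflate e (A (c *\<^sub>C x)) = c *\<^sub>C deflate e (A x)" for c x
    by (simp add: deflate_def contraction_linear[OF A] cinner_scaleC_left scaleC_diff_right scaleC_scaleC)
  have "bounded_linear (\<lambda>x. deflate e (A x))"
  proof (rule bounded_linear_intro[where K = 1])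
    show "deflate e (A (x + y)) = deflate e (A x) + deflate e (A y)" for x y
      by (simp add: deflate_def contraction_linear[OF A] cinner_add_left scaleC_add_left)
    show "deflate e (A (r *\<^sub>R x)) = r *\<^sub>R deflate e (A x)" for r x
      by (simp add: scaleR_scaleC C)
  qed (use le in auto)
  moreover have "onorm (\<lambda>x. deflate e (A x)) \<le> 1"
    by (rule onorm_bound) (use le in auto)
  ultimately show ?thesis using C by (simp add: contraction_def)
qed

section \<open>Factorization of h at a zero\<close>

text \<open>Follows from (I - w A)^-1 e = e + w (I - w A)^-1 A e. It makes the diagonal entry of the
  resolvent at e an instance of \<open>resolvent_fun\<close>, hence holomorphic.\<close>

lemma resolvent_fun_eq_cinner_resolvent:
  fixes A :: "'a::complex_hilbert \<Rightarrow> 'a"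
  assumes A: "contraction A" and e: "norm e = 1" and w: "cmod w < 1"
  shows "resolvent_fun A (A e) e w = cinner (inv (\<lambda>x. x - w *\<^sub>C A x) e) e"
proof -
  define v where "v = inv (\<lambda>x. x - w *\<^sub>C A x) (A e)"
  have v: "v - w *\<^sub>C A v = A e" unfolding v_def by (rule resolvent_eqn[OF A w])
  have "e + w *\<^sub>C v - w *\<^sub>C A (e + w *\<^sub>C v) = e + w *\<^sub>C (v - w *\<^sub>C A v) - w *\<^sub>C A e"
    by (simp add: contraction_linear[OF A] scaleC_add_right scaleC_diff_right)
  also have "\<dots> = e" by (simp add: v)
  finally have "inv (\<lambda>x. x - w *\<^sub>C A x) e = e + w *\<^sub>C v"
    by (rule resolvent_unique[OF A w])
  then show ?thesis
    using e by (simp add: resolvent_fun_def cinner_add_left cinner_scaleC_left cinner_self flip: v_def)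
qed

text \<open>If u = (I - w A)^-1 e were orthogonal to e = u - w A u, then the square of
  \<open>norm u\<close> would be at most \<open>cmod w\<close> times itself, forcing u = 0 and so e
  = 0. Hence this factor of h contributes no zeros.\<close>

lemma cinner_resolvent_nonzero:
  fixes A :: "'a::complex_hilbert \<Rightarrow> 'a"
  assumes A: "contraction A" and e: "e \<noteq> 0" and w: "cmod w < 1"
  shows "cinner (inv (\<lambda>x. x - w *\<^sub>C A x) e) e \<noteq> 0"
proof
  define u where "u = inv (\<lambda>x. x - w *\<^sub>C A x) e"
  have u: "u - w *\<^sub>C A u = e" unfolding u_def by (rule resolvent_eqn[OF A w])
  assume "cinner (inv (\<lambda>x. x - w *\<^sub>C A x) e) e = 0"
  then have "cinner u (u - w *\<^sub>C A u) = 0" by (simp add: u flip: u_def)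
  then have "cinner u u = cnj w * cinner u (A u)"
    by (simp add: cinner_diff_right cinner_scaleC_right)
  then have "cmod (cinner u u) = cmod w * cmod (cinner u (A u))"
    by (simp add: norm_mult)
  then have "(norm u)\<^sup>2 = cmod w * cmod (cinner u (A u))"
    by (simp add: cinner_self norm_power)
  also have "\<dots> \<le> cmod w * (norm u * norm u)"
    by (intro mult_left_mono order_trans[OF cinner_Cauchy_Schwarz] contraction_norm_le[OF A]) auto
  finally have "(1 - cmod w) * (norm u)\<^sup>2 \<le> 0"
    by (simp add: algebra_simps power2_eq_square)
  then have "u = 0" using w by (simp add: mult_le_0_iff)
  then have "e = 0" using u contraction_linear(3)[OF A, of 0 0]
    by (metis contraction_norm_le[OF A] diff_self norm_le_zero_iff norm_zero norm_scaleC mult_zero_right norm_eq_zero)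
  then show False using e by simp
qed

text \<open>In finite dimensions \<open>resolvent_fun A \<phi> \<psi> w\<close> is \<open>det (I - w B) / det (I - w A)\<close> with
  \<open>B\<close> as above; the factorization is the Schur complement formula for both determinants.\<close>

lemma resolvent_fun_deflation:
  fixes A :: "'a::complex_hilbert \<Rightarrow> 'a"
  assumes A: "contraction A" and z: "cmod z < 1" and h0: "resolvent_fun A \<phi> \<psi> z = 0"
  obtains e where "norm e = 1"
    "1 / cmod z - 1 \<le> cmod (cinner \<phi> e) * cmod (cinner \<psi> e)"
    "\<And>w. cmod w < 1 \<Longrightarrow> resolvent_fun A \<phi> \<psi> w =
       (1 - w / z) * resolvent_fun A (A e) e w *
       resolvent_fun (\<lambda>x. deflate e (A x)) (deflate e \<phi>) (deflate e \<psi>) w"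
proof -
  define x where "x = inv (\<lambda>x. x - z *\<^sub>C A x) \<phi>"
  define n where "n = complex_of_real (norm x)"
  define e where "e = (1 / n) *\<^sub>C x"
  have x: "x - z *\<^sub>C A x = \<phi>" unfolding x_def by (rule resolvent_eqn[OF A z])
  have zx: "1 + z * cinner x \<psi> = 0" using h0 by (simp add: resolvent_fun_def x_def)
  have z0: "z \<noteq> 0" using zx by auto
  have "x \<noteq> 0" using zx cinner_diff_left[of x x \<psi>] by auto
  then have n0: "n \<noteq> 0" by (simp add: n_def)
  have e: "norm e = 1" using n0 by (simp add: e_def norm_scaleC n_def norm_divide)
  have ee: "cinner e e = 1" using e by (simp add: cinner_self)
  have eqe: "e - z *\<^sub>C A e = (1 / n) *\<^sub>C \<phi>"
    by (simp add: e_def contraction_linear[OF A] scaleC_diff_right scaleC_scaleC mult.commute flip: x)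
  have epsi: "z * cinner e \<psi> = - 1 / n"
    using zx n0 by (simp add: e_def cinner_scaleC_left field_simps add_eq_0_iff)
  have psie: "cmod (cinner \<psi> e) = cmod (cinner e \<psi>)"
    by (subst cinner_commute) simp
  \<comment> \<open>Pairing the eigenvector equation with e and eliminating n through
    \<open>epsi\<close> expresses 1 / z as the diagonal entry of the perturbed operator at
    e.\<close>
  have "1 - z * cinner (A e) e = cinner \<phi> e / n"
    using arg_cong[OF eqe, of "\<lambda>v. cinner v e"]
    by (simp add: cinner_diff_left cinner_scaleC_left ee)
  also have "\<dots> = - (z * cinner e \<psi>) * cinner \<phi> e" by (simp add: epsi)
  finally have "1 / z = cinner (A e) e - cinner \<phi> e * cinner e \<psi>"
    using z0 by (simp add: field_simps)
  then have "1 / cmod z \<le> cmod (cinner (A e) e) + cmod (cinner \<phi> e * cinner e \<psi>)"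
    by (metis norm_divide norm_one norm_triangle_ineq4)
  also have "cmod (cinner (A e) e) \<le> 1"
    using cinner_Cauchy_Schwarz[of "A e" e] contraction_norm_le[OF A, of e] e by simp
  finally have bound: "1 / cmod z - 1 \<le> cmod (cinner \<phi> e) * cmod (cinner \<psi> e)"
    by (simp add: norm_mult psie)
  have fact: "resolvent_fun A \<phi> \<psi> w =
       (1 - w / z) * resolvent_fun A (A e) e w *
       resolvent_fun (\<lambda>x. deflate e (A x)) (deflate e \<phi>) (deflate e \<psi>) w"
    if w: "cmod w < 1" for w
  proof -
    define y where "y = inv (\<lambda>x. x - w *\<^sub>C A x) \<phi>"
    define u where "u = inv (\<lambda>x. x - w *\<^sub>C A x) e"
    define y' where "y' = inv (\<lambda>x. x - w *\<^sub>C deflate e (A x)) (deflate e \<phi>)"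
    define U where "U = cinner u e"
    define c where "c = cinner \<phi> e + w * cinner (A y') e"
    have y: "y - w *\<^sub>C A y = \<phi>" unfolding y_def by (rule resolvent_eqn[OF A w])
    have u: "u - w *\<^sub>C A u = e" unfolding u_def by (rule resolvent_eqn[OF A w])
    have y': "y' - w *\<^sub>C deflate e (A y') = deflate e \<phi>"
      unfolding y'_def by (rule resolvent_eqn[OF contraction_deflate[OF A e] w])
    have perp: "cinner (deflate e v) e = 0" for v
      by (simp add: deflate_def cinner_diff_left cinner_scaleC_left ee)
    have y'e: "cinner y' e = 0"
      using arg_cong[OF y', of "\<lambda>v. cinner v e"]
      by (simp add: cinner_diff_left cinner_scaleC_left perp)
    \<comment> \<open>c collects the components along e that the two projections removed; undoing
      them gives an equation for A itself, whence y' = y - c u.\<close>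
    have "y' - w *\<^sub>C A y' = \<phi> - c *\<^sub>C e"
      using y' by (simp add: c_def deflate_def scaleC_diff_right scaleC_scaleC scaleC_add_left
          algebra_simps)
    from resolvent_unique[OF A w this] have "inv (\<lambda>x. x - w *\<^sub>C A x) (\<phi> - c *\<^sub>C e) = y'" .
    moreover have "(y - c *\<^sub>C u) - w *\<^sub>C A (y - c *\<^sub>C u)
        = (y - w *\<^sub>C A y) - c *\<^sub>C (u - w *\<^sub>C A u)"
      by (simp add: contraction_linear[OF A] scaleC_diff_right scaleC_scaleC mult.commute)
    then have "(y - c *\<^sub>C u) - w *\<^sub>C A (y - c *\<^sub>C u) = \<phi> - c *\<^sub>C e"
      by (simp only: y u)
    from resolvent_unique[OF A w this]
    have "inv (\<lambda>x. x - w *\<^sub>C A x) (\<phi> - c *\<^sub>C e) = y - c *\<^sub>C u" .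
    ultimately have y'_eq: "y' = y - c *\<^sub>C u" by simp
    \<comment> \<open>Since e - z A e is a multiple of \<phi>, applying the resolvent at w gives a
      linear relation between e, u and y. Pairing it with \<psi> and with e yields \<open>h\<close>
      and \<open>wr\<close>.\<close>
    have "z *\<^sub>C e - w *\<^sub>C A (z *\<^sub>C e) = (z - w) *\<^sub>C e + w *\<^sub>C (e - z *\<^sub>C A e)"
      by (simp add: contraction_linear[OF A] scaleC_diff_left scaleC_diff_right scaleC_scaleC)
    also have "\<dots> = (z - w) *\<^sub>C e + (w / n) *\<^sub>C \<phi>"
      by (simp add: eqe scaleC_scaleC)
    finally have "inv (\<lambda>x. x - w *\<^sub>C A x) ((z - w) *\<^sub>C e + (w / n) *\<^sub>C \<phi>) = z *\<^sub>C e"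
      by (rule resolvent_unique[OF A w])
    moreover have "((z - w) *\<^sub>C u + (w / n) *\<^sub>C y) - w *\<^sub>C A ((z - w) *\<^sub>C u + (w / n) *\<^sub>C y)
        = (z - w) *\<^sub>C (u - w *\<^sub>C A u) + (w / n) *\<^sub>C (y - w *\<^sub>C A y)"
      by (simp add: contraction_linear[OF A] scaleC_diff_right scaleC_add_right scaleC_scaleC mult.commute)
    then have "((z - w) *\<^sub>C u + (w / n) *\<^sub>C y) - w *\<^sub>C A ((z - w) *\<^sub>C u + (w / n) *\<^sub>C y)
        = (z - w) *\<^sub>C e + (w / n) *\<^sub>C \<phi>"
      by (simp only: y u)
    from resolvent_unique[OF A w this]
    have "inv (\<lambda>x. x - w *\<^sub>C A x) ((z - w) *\<^sub>C e + (w / n) *\<^sub>C \<phi>)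
        = (z - w) *\<^sub>C u + (w / n) *\<^sub>C y" .
    ultimately have ze: "z *\<^sub>C e = (z - w) *\<^sub>C u + (w / n) *\<^sub>C y" by simp
    define s where "s = cinner u \<psi>"
    define t where "t = cinner y \<psi>"
    define r where "r = cinner y e"
    have "- 1 / n = (z - w) * s + w / n * t"
      using arg_cong[OF ze, of "\<lambda>v. cinner v \<psi>"] epsi
      by (simp add: cinner_add_left cinner_scaleC_left s_def t_def)
    then have h: "1 + w * t = (w - z) * n * s"
      using n0 by (simp add: field_simps)
    have "z = (z - w) * U + w / n * r"
      using arg_cong[OF ze, of "\<lambda>v. cinner v e"]
      by (simp add: cinner_add_left cinner_scaleC_left ee U_def r_def)
    then have wr: "w * r = n * (z - (z - w) * U)"
      using n0 by (simp add: field_simps)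
    have r: "r = c * U"
      using y'e by (simp add: y'_eq cinner_diff_left cinner_scaleC_left r_def U_def)
    have h': "resolvent_fun (\<lambda>x. deflate e (A x)) (deflate e \<phi>) (deflate e \<psi>) w
        = 1 + w * (t - c * s)"
    proof -
      have "cinner y' (deflate e \<psi>) = cinner y' \<psi>"
        by (simp add: deflate_def cinner_diff_right cinner_scaleC_right y'e)
      also have "\<dots> = t - c * s"
        by (simp add: y'_eq cinner_diff_left cinner_scaleC_left s_def t_def)
      finally show ?thesis by (simp add: resolvent_fun_def flip: y'_def)
    qed
    \<comment> \<open>Multiplying by U turns the unknown c U into r, which \<open>wr\<close>
      determines; the terms containing U then cancel.\<close>
    have "U * (1 + w * (t - c * s)) = U * (1 + w * t) - w * r * s"
      unfolding r by algebra
    also have "\<dots> = - n * z * s" unfolding h wr by algebra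
    finally have "U * (1 + w * (t - c * s)) = - n * z * s" .
    moreover have "(1 - w / z) * (- n * z * s) = (w - z) * n * s"
      using z0 by (simp add: field_simps)
    ultimately have "(1 - w / z) * (U * (1 + w * (t - c * s))) = (w - z) * n * s"
      by simp
    then show ?thesis
      unfolding resolvent_fun_eq_cinner_resolvent[OF A e w] u_def[symmetric] U_def[symmetric] h'
      by (simp add: resolvent_fun_def h mult.assoc flip: y_def t_def)
  qed
  show ?thesis using that[OF e bound fact] by blast
qed

section \<open>Orders of zeros under deflation\<close>

text \<open>Orders add over the factorization: 1 - w / z has a simple zero at z only, and the middle
  factor has order 0 throughout the disc.\<close>

lemma zorder_resolvent_fun_deflation:
  fixes A :: "'a::complex_hilbert \<Rightarrow> 'a"
  assumes A: "contraction A" and z: "cmod z < 1" and h0: "resolvent_fun A \<phi> \<psi> z = 0"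
  obtains e where "norm e = 1"
    "1 / cmod z - 1 \<le> cmod (cinner \<phi> e) * cmod (cinner \<psi> e)"
    "\<And>p. cmod p < 1 \<Longrightarrow> zorder (resolvent_fun A \<phi> \<psi>) p = of_bool (p = z) +
       zorder (resolvent_fun (\<lambda>x. deflate e (A x)) (deflate e \<phi>) (deflate e \<psi>)) p"
proof -
  obtain e where e: "norm e = 1"
    and bound: "1 / cmod z - 1 \<le> cmod (cinner \<phi> e) * cmod (cinner \<psi> e)"
    and fact: "\<And>w. cmod w < 1 \<Longrightarrow> resolvent_fun A \<phi> \<psi> w =
       (1 - w / z) * resolvent_fun A (A e) e w *
       resolvent_fun (\<lambda>x. deflate e (A x)) (deflate e \<phi>) (deflate e \<psi>) w"
    using resolvent_fun_deflation[OF assms] by metis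
  define h where "h = resolvent_fun A \<phi> \<psi>"
  define U where "U = resolvent_fun A (A e) e"
  define h' where "h' = resolvent_fun (\<lambda>x. deflate e (A x)) (deflate e \<phi>) (deflate e \<psi>)"
  have z0: "z \<noteq> 0" using h0 by (auto simp: resolvent_fun_def)
  have hol: "h holomorphic_on ball 0 1" "U holomorphic_on ball 0 1" "h' holomorphic_on ball 0 1"
    unfolding h_def U_def h'_def
    by (intro resolvent_fun_holomorphic A contraction_deflate[OF A e])+
  have "zorder h p = of_bool (p = z) + zorder h' p" if p: "cmod p < 1" for p
  proof -
    have an: "U analytic_on {p}" "h' analytic_on {p}"
      using hol p by (auto simp: analytic_at intro!: exI[of _ "ball 0 1"])
    have "\<forall>\<^sub>F w in at p. w \<in> ball 0 1"
      using p by (intro eventually_at_in_open') auto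
    then have eq: "\<forall>\<^sub>F w in at p. h w = (1 - w / z) * (U w * h' w)"
      by eventually_elim (simp add: fact h_def U_def h'_def)
    \<comment> \<open>Additivity of orders needs a product that is nonzero near p. Zeros of h are
      isolated because h(0) = 1.\<close>
    have nz: "\<forall>\<^sub>F w in at p. h w \<noteq> 0"
      using non_zero_neighbour_alt[OF hol(1), of p 0] p
      by (auto simp: h_def resolvent_fun_def elim: eventually_mono)
    have nz': "\<forall>\<^sub>F w in at p. (1 - w / z) * (U w * h' w) \<noteq> 0"
      using nz eq by eventually_elim auto
    have "zorder h p = zorder (\<lambda>w. (1 - w / z) * (U w * h' w)) p"
      by (rule zorder_cong[OF eq refl])
    also have "\<dots> = zorder (\<lambda>w. 1 - w / z) p + zorder (\<lambda>w. U w * h' w) p"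
      using an nz' z0 by (intro zorder_times_analytic analytic_intros) auto
    also have "zorder (\<lambda>w. U w * h' w) p = zorder U p + zorder h' p"
      using an by (intro zorder_times_analytic eventually_mono[OF nz']) auto
    also have "U p \<noteq> 0"
      unfolding U_def resolvent_fun_eq_cinner_resolvent[OF A e p]
      using e by (intro cinner_resolvent_nonzero[OF A _ p]) auto
    then have "zorder U p = 0" by (intro zorder_eq_0I an)
    also have "zorder (\<lambda>w. 1 - w / z) p = of_bool (p = z)"
    proof (cases "p = z")
      case True
      have "zorder (\<lambda>w. 1 - w / z) z = 1"
        by (rule zorder_eqI[of UNIV _ "\<lambda>_. - 1 / z"]) (use z0 in \<open>auto simp: field_simps\<close>)
      then show ?thesis using True by simp
    next
      case False
      then show ?thesis using z0 by (auto intro!: zorder_eq_0I analytic_intros)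
    qed
    finally show ?thesis by simp
  qed
  then show ?thesis using that[OF e bound] by (simp add: h_def h'_def)
qed

section \<open>Summation over the zeros\<close>

text \<open>Cauchy-Schwarz in the plane, by Lagrange's identity. The hypotheses have the shape in
  which \<open>norm_deflate\<close> splits the norms of \<phi> and \<psi>.\<close>

lemma mult_add_mult_le_of_sum_squares:
  fixes a b c d p q :: real
  assumes "a\<^sup>2 + c\<^sup>2 = p\<^sup>2" "b\<^sup>2 + d\<^sup>2 = q\<^sup>2" "0 \<le> p" "0 \<le> q"
  shows "a * b + c * d \<le> p * q"
proof (rule power2_le_imp_le)
  have "(p * q)\<^sup>2 = (a\<^sup>2 + c\<^sup>2) * (b\<^sup>2 + d\<^sup>2)"
    using assms by (simp add: power_mult_distrib)
  also have "\<dots> = (a * b + c * d)\<^sup>2 + (a * d - c * b)\<^sup>2" by algebra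
  finally show "(a * b + c * d)\<^sup>2 \<le> (p * q)\<^sup>2" by simp
qed (use assms in simp)

text \<open>The multiset lists finitely many zeros with repetition; each induction step deflates at
  one of them, so A, \<phi> and \<psi> must vary. Requiring only an upper bound on the
  multiplicities makes the hypothesis survive removal of a single copy.\<close>

lemma sum_mset_zeros_le:
  fixes A :: "'a::complex_hilbert \<Rightarrow> 'a"
  assumes "contraction A" "set_mset M \<subseteq> ball 0 1"
    "\<And>z. z \<in># M \<Longrightarrow> int (count M z) \<le> zorder (resolvent_fun A \<phi> \<psi>) z"
  shows "(\<Sum>z\<in>#M. 1 / cmod z - 1) \<le> norm \<phi> * norm \<psi>"
  using assms
proof (induction M arbitrary: A \<phi> \<psi>)
  case (add z M)
  let ?h = "resolvent_fun A \<phi> \<psi>"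
  have z: "cmod z < 1" using add.prems by auto
  have "zorder ?h z > 0" using add.prems(3)[of z] by simp
  moreover have "?h analytic_on {z}"
    using resolvent_fun_holomorphic[OF add.prems(1)] z
    by (auto simp: analytic_at intro!: exI[of _ "ball 0 1"])
  ultimately have h0: "?h z = 0" using zorder_eq_0I by fastforce
  obtain e where e: "norm e = 1"
    and bound: "1 / cmod z - 1 \<le> cmod (cinner \<phi> e) * cmod (cinner \<psi> e)"
    and ord: "\<And>p. cmod p < 1 \<Longrightarrow> zorder ?h p = of_bool (p = z) +
       zorder (resolvent_fun (\<lambda>x. deflate e (A x)) (deflate e \<phi>) (deflate e \<psi>)) p"
    using zorder_resolvent_fun_deflation[OF add.prems(1) z h0] by metis
  have "(\<Sum>p\<in>#M. 1 / cmod p - 1) \<le> norm (deflate e \<phi>) * norm (deflate e \<psi>)"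
  proof (rule add.IH)
    show "contraction (\<lambda>x. deflate e (A x))" by (rule contraction_deflate[OF add.prems(1) e])
    \<comment> \<open>Removing one copy of z lowers the count at z by one, exactly as deflation
      lowers the order there; other points keep both.\<close>
    show "int (count M p)
        \<le> zorder (resolvent_fun (\<lambda>x. deflate e (A x)) (deflate e \<phi>) (deflate e \<psi>)) p"
      if "p \<in># M" for p
      using add.prems(3)[of p] ord[of p] add.prems(2) that by (auto split: if_splits)
  qed (use add.prems in auto)
  then have "(\<Sum>p\<in>#add_mset z M. 1 / cmod p - 1)
      \<le> cmod (cinner \<phi> e) * cmod (cinner \<psi> e) + norm (deflate e \<phi>) * norm (deflate e \<psi>)"
    using bound by simp
  also have "\<dots> \<le> norm \<phi> * norm \<psi>"
    by (rule mult_add_mult_le_of_sum_squares) (simp_all add: norm_deflate[OF e])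
  finally show ?case .
qed simp

theorem theorem1:
  fixes \<phi> \<psi> :: "'a::complex_hilbert" and A :: "'a \<Rightarrow> 'a"
  assumes "separable_space (euclidean :: 'a topology)"
    and "contraction A"
  shows "(\<lambda>z. of_int (zorder (resolvent_fun A \<phi> \<psi>) z) * (1 / cmod z - 1))
           summable_on disc_zeros (resolvent_fun A \<phi> \<psi>)
       \<and> (\<Sum>\<^sub>\<infinity>z\<in>disc_zeros (resolvent_fun A \<phi> \<psi>).
             of_int (zorder (resolvent_fun A \<phi> \<psi>) z) * (1 / cmod z - 1))
           \<le> norm \<phi> * norm \<psi>"
proof -
  let ?h = "resolvent_fun A \<phi> \<psi>"
  let ?f = "\<lambda>z. of_int (zorder ?h z) * (1 / cmod z - 1)"
  \<comment> \<open>The point 0, where h equals 1, witnesses that h is not identically zero, so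
    \<open>zorder\<close> is a genuine order of vanishing.\<close>
  have ord: "zorder ?h z \<ge> 0" if "z \<in> disc_zeros ?h" for z
    using zorder_exist_zero[OF resolvent_fun_holomorphic[OF assms(2), of \<phi> \<psi>], of z] that
    by (force simp: disc_zeros_def resolvent_fun_def intro: bexI[of _ 0])
  have pos: "?f z \<ge> 0" if "z \<in> disc_zeros ?h" for z
  proof -
    have "z \<noteq> 0" "cmod z < 1" using that by (auto simp: disc_zeros_def resolvent_fun_def)
    then show ?thesis using ord[OF that] by simp
  qed
  have le: "sum ?f F \<le> norm \<phi> * norm \<psi>" if F: "finite F" "F \<subseteq> disc_zeros ?h" for F
  proof -
    \<comment> \<open>Each zero in F is repeated according to its order, turning the weighted sum
      into a sum over a multiset.\<close>
    define M where "M = (\<Sum>z\<in>F. replicate_mset (nat (zorder ?h z)) z)"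
    have "(\<Sum>z\<in>#M. 1 / cmod z - 1)
        = (\<Sum>z\<in>F. of_nat (nat (zorder ?h z)) * (1 / cmod z - 1))"
      using F(1) unfolding M_def by (induction F) auto
    also have "\<dots> = sum ?f F"
      using F(2) ord by (intro sum.cong) auto
    finally have sum: "(\<Sum>z\<in>#M. 1 / cmod z - 1) = sum ?f F" .
    have count: "count M z = (if z \<in> F then nat (zorder ?h z) else 0)" for z
      using F(1) by (auto simp: M_def count_sum)
    have mem: "z \<in> F" if "z \<in># M" for z
      using that count[of z] by (metis count_eq_zero_iff)
    show ?thesis
      unfolding sum[symmetric]
    proof (rule sum_mset_zeros_le[OF assms(2)])
      show "set_mset M \<subseteq> ball 0 1" using mem F(2) by (auto simp: disc_zeros_def subset_iff)
      show "int (count M z) \<le> zorder ?h z" if "z \<in># M" for z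
        using mem[OF that] F(2) ord by (auto simp: count)
    qed
  qed
  \<comment> \<open>The terms are nonnegative, so the uniform bound on finite sums gives both
    summability and the bound on the infinite sum.\<close>
  have "?f summable_on disc_zeros ?h"
    by (rule nonneg_bdd_above_summable_on[OF pos]) (use le in \<open>auto intro!: bdd_aboveI\<close>)
  then show ?thesis using le by (auto intro: infsum_le_finite_sums)
qed

end
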